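(* Let $A(s)=\binom{Q(s)}{T(s)}$ be an $n\times n$ DCLM-polynomial matrix, let $(p,q)$ be an optimal solution of $\mathrm{D}(A)$, and let $U_Q(s)$ be the unimodular matrix constructed from $A(s)$ and $(p,q)$ as in the context. Then $\bar{A}(s)=\binom{U_Q(s)Q(s)}{T(s)}$ is also dimensionally consistent.
   Context: $\mathbf{K}\subseteq\mathbf{F}$ are fields. An LM-polynomial matrix is $A(s)=\binom{Q(s)}{T(s)}$ with $Q(s)=\sum_k s^kQ_k$, $T(s)=\sum_k s^kT_k$, where the $Q_k$ are matrices over $\mathbf{K}$ and the set of nonzero entries of all the $T_k$ (in $\mathbf{F}$) is algebraically independent over $\mathbf{K}$. Row sets of $Q,T$ are $R_Q,R_T$, the row set of $A$ is $R=R_Q\cup R_T$, the column set is $C$; $m_Q=|R_Q|$. $A(s)$ is dimensionally consistent (a DCLM-polynomial matrix) if $Q(s)=\operatorname{diag}(s^{-\lambda_1},\dots,s^{-\lambda_{m_Q}})\,Q(1)\,\operatorname{diag}(s^{\mu_1},\dots,s^{\mu_n})$ for some integers $\lambda_1,\dots,\lambda_{m_Q},\mu_1,\dots,\mu_n$; fix such integers. Problem $\mathrm{D}(A)$: minimize $\sum_{j\in C}q_j-\sum_{i\in R}p_i$ subject to $q_j-p_i\ge\deg A_{i,j}(s)$ whenever $A_{i,j}(s)\ne0$, $p_i,q_j\in\mathbb{Z}$. For feasible $(p,q)$ the tight coefficient matrix $A^\#=\binom{Q^\#}{T^\#}$ has as $(i,j)$ entry the coefficient of $s^{q_j-p_i}$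 in $A_{i,j}(s)$. The term-rank $\operatorname{t-rank}B$ is the maximum size of a matching in the bipartite graph of nonzero entries of $B$. Construction of $U_Q(s)$: let $J^*\subseteq C$ minimize $\operatorname{rank}Q^\#[R_Q,J]+\operatorname{t-rank}T^\#[R_T,J]+|C\setminus J|$ over $J\subseteq C$. For $k\in\mathbb{Z}$ let $R_k=\{i\in R_Q:p_i-\lambda_i=k\}$, $C_k=\{j\in C:q_j-\mu_j=k\}$, $Q_k^\#=Q^\#[R_k,C_k]$ ($Q^\#$ is block diagonal with these blocks). With the rows of each $R_k$ sorted in ascending order of $p$, let $U_k$ be a nonsingular upper-triangular matrix over $\mathbf{K}$ with $\operatorname{rank}(U_kQ_k^\#)[R_k,C_k\cap J^*]=\operatorname{t-rank}(U_kQ_k^\#)[R_k,C_k\cap J^*]$. Let $U$ be the block diagonal matrix with diagonal blocks $U_k$ $(k\in\mathbb{Z})$, let $D_p(s)$ be the diagonal matrix indexed by $R_Q$ (ordered by blocks $R_k$) with $(i,i)$ entry $s^{p_i}$, and $U_Q(s)=D_p^{-1}(s)\,U\,D_p(s)$. *)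

theory Defs
  imports
    "Jordan_Normal_Form.DL_Rank"
    "Jordan_Normal_Form.DL_Submatrix"
    "HOL-Computational_Algebra.Polynomial_Factorial"
    "HOL-Library.Poly_Mapping"
begin

definition is_subfield :: "'f::field set \<Rightarrow> bool" where
  "is_subfield K \<longleftrightarrow>
     0 \<in> K \<and> 1 \<in> K \<and>
     (\<forall>x\<in>K. \<forall>y\<in>K. x + y \<in> K \<and> x * y \<in> K) \<and>
     (\<forall>x\<in>K. - x \<in> K \<and> inverse x \<in> K)"

(* A multivariate polynomial in variables of type 'i is a finitely supported map from
   monomials (finitely supported exponent functions) to coefficients. *)
definition eval_mpoly :: "('i \<Rightarrow> 'f) \<Rightarrow> (('i \<Rightarrow>\<^sub>0 nat) \<Rightarrow>\<^sub>0 'f) \<Rightarrow> 'f::field" where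
  "eval_mpoly t P =
     (\<Sum>m\<in>Poly_Mapping.keys P. Poly_Mapping.lookup P m *
        (\<Prod>x\<in>Poly_Mapping.keys m. t x ^ Poly_Mapping.lookup m x))"

definition alg_independent :: "'f::field set \<Rightarrow> 'i set \<Rightarrow> ('i \<Rightarrow> 'f) \<Rightarrow> bool" where
  "alg_independent K I t \<longleftrightarrow>
     (\<forall>P :: ('i \<Rightarrow>\<^sub>0 nat) \<Rightarrow>\<^sub>0 'f.
        (\<forall>m. Poly_Mapping.lookup P m \<in> K) \<longrightarrow>
        (\<forall>m\<in>Poly_Mapping.keys P. Poly_Mapping.keys m \<subseteq> I) \<longrightarrow>
        eval_mpoly t P = 0 \<longrightarrow> P = 0)"

(* The independence condition is on the family of nonzero entries, indexed by
   (row, column, exponent): entries at different positions are different elements. *)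
definition LM_poly_matrix :: "'f::field set \<Rightarrow> 'f poly mat \<Rightarrow> 'f poly mat \<Rightarrow> bool" where
  "LM_poly_matrix K Q T \<longleftrightarrow>
     dim_col Q = dim_col T \<and>
     (\<forall>i<dim_row Q. \<forall>j<dim_col Q. \<forall>k. coeff (Q $$ (i, j)) k \<in> K) \<and>
     alg_independent K
       {(i, j, k). i < dim_row T \<and> j < dim_col T \<and> coeff (T $$ (i, j)) k \<noteq> 0}
       (\<lambda>(i, j, k). coeff (T $$ (i, j)) k)"

(* Negative powers of s occur, so s lives in the field F(s) of rational functions. *)
definition svar :: "'f::field poly fract" where
  "svar = to_fract (monom 1 1)"

definition diag_spow :: "nat \<Rightarrow> (nat \<Rightarrow> int) \<Rightarrow> 'f::field poly fract mat" where
  "diag_spow m e = mat_diag m (\<lambda>i. svar powi e i)"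

abbreviation rat_mat :: "'f::field poly mat \<Rightarrow> 'f poly fract mat" where
  "rat_mat \<equiv> map_mat to_fract"

definition dim_consistent_with ::
    "(nat \<Rightarrow> int) \<Rightarrow> (nat \<Rightarrow> int) \<Rightarrow> 'f::field poly mat \<Rightarrow> bool" where
  "dim_consistent_with lam mu Q \<longleftrightarrow>
     rat_mat Q =
       diag_spow (dim_row Q) (\<lambda>i. - lam i) *
       rat_mat (map_mat (\<lambda>f. [:poly f 1:]) Q) *
       diag_spow (dim_col Q) mu"

definition DCLM_poly_matrix :: "'f::field set \<Rightarrow> 'f poly mat \<Rightarrow> 'f poly mat \<Rightarrow> bool" where
  "DCLM_poly_matrix K Q T \<longleftrightarrow>
     LM_poly_matrix K Q T \<and> (\<exists>lam mu. dim_consistent_with lam mu Q)"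

definition dual_feasible ::
    "'f::field poly mat \<Rightarrow> (nat \<Rightarrow> int) \<Rightarrow> (nat \<Rightarrow> int) \<Rightarrow> bool" where
  "dual_feasible A p q \<longleftrightarrow>
     (\<forall>i<dim_row A. \<forall>j<dim_col A.
        A $$ (i, j) \<noteq> 0 \<longrightarrow> q j - p i \<ge> int (degree (A $$ (i, j))))"

definition dual_objective ::
    "'f::field poly mat \<Rightarrow> (nat \<Rightarrow> int) \<Rightarrow> (nat \<Rightarrow> int) \<Rightarrow> int" where
  "dual_objective A p q = (\<Sum>j<dim_col A. q j) - (\<Sum>i<dim_row A. p i)"

definition dual_optimal ::
    "'f::field poly mat \<Rightarrow> (nat \<Rightarrow> int) \<Rightarrow> (nat \<Rightarrow> int) \<Rightarrow> bool" where
  "dual_optimal A p q \<longleftrightarrow>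
     dual_feasible A p q \<and>
     (\<forall>p' q'. dual_feasible A p' q' \<longrightarrow> dual_objective A p q \<le> dual_objective A p' q')"

definition tight_coeff_mat ::
    "'f::field poly mat \<Rightarrow> (nat \<Rightarrow> int) \<Rightarrow> (nat \<Rightarrow> int) \<Rightarrow> 'f mat" where
  "tight_coeff_mat A p q =
     mat (dim_row A) (dim_col A)
       (\<lambda>(i, j). if q j - p i \<ge> 0 then coeff (A $$ (i, j)) (nat (q j - p i)) else 0)"

definition mat_rank :: "'f::field mat \<Rightarrow> nat" where
  "mat_rank B = vec_space.rank (dim_row B) B"

definition matching :: "'f::zero mat \<Rightarrow> (nat \<times> nat) set \<Rightarrow> bool" where
  "matching B M \<longleftrightarrow>
     M \<subseteq> {(i, j). i < dim_row B \<and> j < dim_col B \<and> B $$ (i, j) \<noteq> 0} \<and>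
     inj_on fst M \<and> inj_on snd M"

definition term_rank :: "'f::zero mat \<Rightarrow> nat" where
  "term_rank B = Max (card ` {M. matching B M})"

definition row_class :: "nat \<Rightarrow> (nat \<Rightarrow> int) \<Rightarrow> (nat \<Rightarrow> int) \<Rightarrow> int \<Rightarrow> nat set" where
  "row_class mQ p lam k = {i. i < mQ \<and> p i - lam i = k}"

definition col_class :: "nat \<Rightarrow> (nat \<Rightarrow> int) \<Rightarrow> (nat \<Rightarrow> int) \<Rightarrow> int \<Rightarrow> nat set" where
  "col_class n q mu k = {j. j < n \<and> q j - mu j = k}"

(* The submatrix of B with rows listed in the order of rs and columns Cs in increasing order. *)
definition ordered_block :: "'f mat \<Rightarrow> nat list \<Rightarrow> nat set \<Rightarrow> 'f mat" where
  "ordered_block B rs Cs = mat (length rs) (card Cs) (\<lambda>(a, b). B $$ (rs ! a, pick Cs b))"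

(* The columns of M are indexed by the increasing enumeration of Cs; keep those in J. *)
definition restrict_cols :: "'f mat \<Rightarrow> nat set \<Rightarrow> nat set \<Rightarrow> 'f mat" where
  "restrict_cols M Cs J = submatrix M UNIV {b. b < card Cs \<and> pick Cs b \<in> J}"

(* The block diagonal matrix with blocks U k, indexed by the original row labels: the rows
   and columns of the block U k carry the labels ord k ! 0, ord k ! 1, ... *)
definition block_diag_matrix ::
    "nat \<Rightarrow> (nat \<Rightarrow> int) \<Rightarrow> (int \<Rightarrow> nat list) \<Rightarrow> (int \<Rightarrow> 'f mat) \<Rightarrow> 'f::zero mat" where
  "block_diag_matrix m cls ord U =
     (let pos = (\<lambda>i. inv_into {..<length (ord (cls i))} ((!) (ord (cls i))) i) in
      mat m m (\<lambda>(i, j). if cls i = cls j then U (cls i) $$ (pos i, pos j) else 0))"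

definition UQ_matrix ::
    "nat \<Rightarrow> (nat \<Rightarrow> int) \<Rightarrow> (nat \<Rightarrow> int) \<Rightarrow> (int \<Rightarrow> nat list) \<Rightarrow> (int \<Rightarrow> 'f mat)
      \<Rightarrow> 'f::field poly fract mat" where
  "UQ_matrix mQ p lam ord U =
     diag_spow mQ (\<lambda>i. - p i) *
     rat_mat (map_mat (\<lambda>c. [:c:]) (block_diag_matrix mQ (\<lambda>i. p i - lam i) ord U)) *
     diag_spow mQ p"

end

(* Write B for the block diagonal matrix U and c for Q(1), so that Q_lj = c_lj s^(mu_j - lam_l).
   The entry (i,j) of U_Q Q is the sum over l of B_il c_lj s^(p_l - p_i - lam_l + mu_j).
   If B_il is nonzero then i and l lie in the same class, i.e. p_l - lam_l = p_i - lam_i, so the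
   exponent is mu_j - lam_i: the same lam and mu witness dimensional consistency. Upper
   triangularity and the order of the rows give p_l - p_i \<ge> 0, so U_Q is a polynomial matrix. *)
theory Submission
  imports Defs "Subresultants.More_Homomorphisms"
begin

lemma svar_nonzero: "svar \<noteq> (0 :: 'f::field poly fract)"
  by (simp add: svar_def)

lemma to_fract_monom: "to_fract (monom c k) = to_fract [:c:] * (svar :: 'f::field poly fract) ^ k"
proof -
  have "monom c k = [:c:] * monom 1 1 ^ k"
    by (simp add: monom_power smult_monom)
  then show ?thesis
    unfolding svar_def by (simp only: to_fract_hom.hom_mult to_fract_hom.hom_power)
qed

text \<open>Bridge between polynomials and Laurent monomials in \<open>svar\<close>.
  \<open>nat\<close> truncates negative exponents to 0, so the order of the exponents matters
  wherever \<open>c\<close> is nonzero; for \<open>c = 0\<close> both sides vanish.\<close>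

lemma to_fract_monom_nat_diff:
  assumes "c \<noteq> 0 \<Longrightarrow> a \<le> b"
  shows "to_fract (monom c (nat (b - a))) =
    svar powi (- a) * to_fract [:c:] * (svar :: 'f::field poly fract) powi b"
proof (cases "c = 0")
  case False
  then have "svar powi (b - a) = (svar :: 'f poly fract) ^ nat (b - a)"
    using assms by (simp add: power_int_def)
  moreover have "svar powi (b - a) = svar powi (- a) * (svar :: 'f poly fract) powi b"
    by (simp add: power_int_add[symmetric] svar_nonzero)
  ultimately show ?thesis
    by (simp add: to_fract_monom)
qed simp

lemma diag_spow_carrier [simp]: "diag_spow m e \<in> carrier_mat m m"
  by (simp add: diag_spow_def)

lemma diag_spow_conj_eq:
  fixes A :: "'f::field poly fract mat"
  assumes "A \<in> carrier_mat m n"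
  shows "diag_spow m a * A * diag_spow n b =
    mat m n (\<lambda>(i, j). svar powi a i * A $$ (i, j) * svar powi b j)"
proof -
  have "diag_spow m a * A = mat m n (\<lambda>(i, j). svar powi a i * A $$ (i, j))"
    unfolding diag_spow_def using assms by (rule mat_diag_mult_left)
  moreover have "\<dots> * diag_spow n b =
      mat m n (\<lambda>(i, j). svar powi a i * A $$ (i, j) * svar powi b j)"
    unfolding diag_spow_def by (subst mat_diag_mult_right[of _ m n]) auto
  ultimately show ?thesis
    by simp
qed

text \<open>The diagonal factors scale rows and columns, so the matrix equation splits into
  independent equations for the entries: each entry is its value at 1 times a single power of s. The
  main proof uses this form for \<open>Q\<close> and establishes it for the transformed
  matrix.\<close>

lemma dim_consistent_with_iff:
  assumes "Q \<in> carrier_mat m n"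
  shows "dim_consistent_with lam mu Q \<longleftrightarrow>
    (\<forall>i<m. \<forall>j<n. to_fract (Q $$ (i, j)) =
      svar powi (- lam i) * to_fract [:poly (Q $$ (i, j)) 1:] * svar powi mu j)"
proof -
  have "dim_consistent_with lam mu Q \<longleftrightarrow> rat_mat Q =
      mat m n (\<lambda>(i, j). svar powi (- lam i) *
        rat_mat (map_mat (\<lambda>f. [:poly f 1:]) Q) $$ (i, j) * svar powi mu j)"
    unfolding dim_consistent_with_def carrier_matD[OF assms]
    by (subst diag_spow_conj_eq) (use assms in auto)
  also have "\<dots> \<longleftrightarrow> (\<forall>i<m. \<forall>j<n. to_fract (Q $$ (i, j)) =
      svar powi (- lam i) * to_fract [:poly (Q $$ (i, j)) 1:] * svar powi mu j)"
    unfolding mat_eq_iff using assms by simp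
  finally show ?thesis .
qed

lemma is_subfield_sum:
  assumes "is_subfield K" "\<And>x. x \<in> A \<Longrightarrow> f x \<in> K"
  shows "sum f A \<in> K"
proof -
  have "0 \<in> K" and add: "\<And>x y. x \<in> K \<Longrightarrow> y \<in> K \<Longrightarrow> x + y \<in> K"
    using assms(1) by (simp_all add: is_subfield_def)
  then show ?thesis
    using assms(2)
  proof (induction A rule: infinite_finite_induct)
    case (insert x A)
    then have "f x + sum f A \<in> K"
      by (intro add) auto
    then show ?case
      using insert by simp
  qed simp_all
qed

lemma is_subfield_coeff_mult:
  assumes "is_subfield K" "\<And>k. coeff f k \<in> K" "\<And>k. coeff g k \<in> K"
  shows "coeff (f * g) k \<in> K"
  unfolding coeff_mult
proof (rule is_subfield_sum[OF assms(1)])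
  have "\<And>x y. x \<in> K \<Longrightarrow> y \<in> K \<Longrightarrow> x * y \<in> K"
    using assms(1) by (simp add: is_subfield_def)
  then show "coeff f i * coeff g (k - i) \<in> K" for i
    using assms(2,3) by this
qed

text \<open>Coefficients of the product are sums of products of coefficients, under which a subfield
  is closed. This keeps the transformed upper part over \<open>K\<close>.\<close>

lemma is_subfield_coeff_mult_mat:
  assumes "is_subfield K" "A \<in> carrier_mat l m" "B \<in> carrier_mat m n"
    and "\<And>i j k. i < l \<Longrightarrow> j < m \<Longrightarrow> coeff (A $$ (i, j)) k \<in> K"
    and "\<And>i j k. i < m \<Longrightarrow> j < n \<Longrightarrow> coeff (B $$ (i, j)) k \<in> K"
    and "i < l" "j < n"
  shows "coeff ((A * B) $$ (i, j)) k \<in> K"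
proof -
  have "coeff ((A * B) $$ (i, j)) k = (\<Sum>h<m. coeff (A $$ (i, h) * B $$ (h, j)) k)"
    using assms(2,3,6,7) by (simp add: scalar_prod_def coeff_sum atLeast0LessThan)
  also have "\<dots> \<in> K"
    using assms(4-7) by (intro is_subfield_sum is_subfield_coeff_mult assms(1)) simp_all
  finally show ?thesis .
qed

lemma block_diag_matrix_carrier [simp]: "block_diag_matrix m cls ord U \<in> carrier_mat m m"
  by (simp add: block_diag_matrix_def Let_def)

text \<open>Entries between different classes are 0 by construction, so a nonzero entry comes from
  one block. Passing from row labels to list positions \<open>a\<close>, \<open>b\<close> makes
  triangularity of the block and sortedness of the list applicable.\<close>

lemma block_diag_matrix_nonzeroE:
  assumes ord: "\<And>k. set (ord k) = {i. i < m \<and> cls i = k}"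
    and "i < m" "j < m" "block_diag_matrix m cls ord U $$ (i, j) \<noteq> 0"
  obtains a b where "cls i = cls j" "a < length (ord (cls i))" "b < length (ord (cls i))"
    "ord (cls i) ! a = i" "ord (cls i) ! b = j"
    "block_diag_matrix m cls ord U $$ (i, j) = U (cls i) $$ (a, b)"
proof -
  let ?o = "ord (cls i)"
  define pos where "pos = inv_into {..<length ?o} ((!) ?o)"
  have eq: "cls i = cls j"
    and val: "block_diag_matrix m cls ord U $$ (i, j) = U (cls i) $$ (pos i, pos j)"
    using assms(2-) by (auto simp: block_diag_matrix_def Let_def pos_def split: if_splits)
  \<comment> \<open>The list of a class contains all its labels, so \<open>inv_into\<close> is
    applied to a point of the image and returns a genuine position, not an arbitrary value.\<close>
  have pos: "pos x < length ?o \<and> ?o ! pos x = x" if "x < m" "cls x = cls i" for x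
  proof -
    have "x \<in> (!) ?o ` {..<length ?o}"
      using that ord[of "cls i"] by (auto simp: set_conv_nth image_iff)
    then show ?thesis
      unfolding pos_def using inv_into_into[of x "(!) ?o" "{..<length ?o}"]
      by (simp add: f_inv_into_f)
  qed
  show thesis
    using that[of "pos i" "pos j"] eq val pos[of i] pos[of j] assms(2,3) by simp
qed

theorem lemma5p2:
  fixes K :: "'f::field set"
    and Q T :: "'f poly mat"
    and n mQ mT :: nat
    and lam mu p q :: "nat \<Rightarrow> int"
    and J :: "nat set"
    and ord :: "int \<Rightarrow> nat list"
    and U :: "int \<Rightarrow> 'f mat"
  defines "Qsharp \<equiv> tight_coeff_mat Q p q"
    and "Tsharp \<equiv> tight_coeff_mat T (\<lambda>i. p (mQ + i)) q"
  assumes K: "is_subfield K"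
    and dims: "Q \<in> carrier_mat mQ n" "T \<in> carrier_mat mT n" "mQ + mT = n"
    and DCLM: "DCLM_poly_matrix K Q T"
    and lam_mu: "dim_consistent_with lam mu Q"
    and optimal: "dual_optimal (Q @\<^sub>r T) p q"
    and J: "is_arg_min
              (\<lambda>J. mat_rank (submatrix Qsharp {..<mQ} J) + term_rank (submatrix Tsharp {..<mT} J)
                   + card ({..<n} - J))
              (\<lambda>J. J \<subseteq> {..<n}) J"
    and ord: "\<And>k. distinct (ord k) \<and> set (ord k) = row_class mQ p lam k \<and> sorted (map p (ord k))"
    and U: "\<And>k. U k \<in> carrier_mat (length (ord k)) (length (ord k))"
           "\<And>k. elements_mat (U k) \<subseteq> K"
           "\<And>k. invertible_mat (U k)"
           "\<And>k. upper_triangular (U k)"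
    and U_rank: "\<And>k. let Ck = col_class n q mu k;
                         B = restrict_cols (U k * ordered_block Qsharp (ord k) Ck) Ck J
                     in mat_rank B = term_rank B"
  shows "\<exists>Qbar. rat_mat Qbar = UQ_matrix mQ p lam ord U * rat_mat Q \<and> DCLM_poly_matrix K Qbar T"
proof -
  define cls where "cls = (\<lambda>i. p i - lam i)"
  define B where "B = block_diag_matrix mQ cls ord U"
  \<comment> \<open>\<open>V\<close> is the polynomial form of \<open>UQ_matrix\<close>: conjugation
    by the powers of s multiplies entry (i,l) of \<open>B\<close> by s^(p_l - p_i). Truncation by
    \<open>nat\<close> is harmless, since this exponent turns out nonnegative wherever
    \<open>B\<close> is nonzero.\<close>
  define V where "V = mat mQ mQ (\<lambda>(i, l). monom (B $$ (i, l)) (nat (p l - p i)))"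
  have B: "B \<in> carrier_mat mQ mQ" and V: "V \<in> carrier_mat mQ mQ"
    by (simp_all add: B_def V_def)
  have VQ: "V * Q \<in> carrier_mat mQ n"
    using V dims(1) by simp
  have set_ord: "set (ord k) = {i. i < mQ \<and> cls i = k}" for k
    using ord[of k] by (simp add: row_class_def cls_def)
  have B_nonzero: "cls i = cls l \<and> p i \<le> p l" and B_in_K_nonzero: "B $$ (i, l) \<in> K"
    if nz: "i < mQ" "l < mQ" "B $$ (i, l) \<noteq> 0" for i l
  proof -
    obtain a b where ab: "cls i = cls l" "a < length (ord (cls i))" "b < length (ord (cls i))"
      "ord (cls i) ! a = i" "ord (cls i) ! b = l" "B $$ (i, l) = U (cls i) $$ (a, b)"
      using block_diag_matrix_nonzeroE[OF set_ord] nz unfolding B_def by metis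
    \<comment> \<open>Entries strictly below the diagonal of the block are 0.\<close>
    have "a \<le> b"
      using U(4)[of "cls i"] U(1)[of "cls i"] ab nz(3) unfolding upper_triangular_def
      by (metis carrier_matD(1) not_le)
    then have "map p (ord (cls i)) ! a \<le> map p (ord (cls i)) ! b"
      using ord[of "cls i"] ab by (intro sorted_nth_mono) auto
    then show "cls i = cls l \<and> p i \<le> p l"
      using ab by simp
    show "B $$ (i, l) \<in> K"
      unfolding ab(6) using elements_matI[OF U(1) ab(2,3) refl] U(2) by blast
  qed
  \<comment> \<open>The zeros between different blocks lie in \<open>K\<close> as well.\<close>
  have B_in_K: "B $$ (i, l) \<in> K" if "i < mQ" "l < mQ" for i l
    using B_in_K_nonzero[OF that] K by (cases "B $$ (i, l) = 0") (auto simp: is_subfield_def)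
  have V_entry: "to_fract (V $$ (i, l)) =
      svar powi (- p i) * to_fract [:B $$ (i, l):] * svar powi p l"
    if "i < mQ" "l < mQ" for i l
    using that B_nonzero[OF that] by (simp add: V_def to_fract_monom_nat_diff)
  have "UQ_matrix mQ p lam ord U =
      diag_spow mQ (\<lambda>i. - p i) * rat_mat (map_mat (\<lambda>c. [:c:]) B) * diag_spow mQ p"
    by (simp add: UQ_matrix_def B_def cls_def)
  also have "\<dots> = rat_mat V"
    using B V V_entry by (subst diag_spow_conj_eq[of _ mQ mQ]) (auto intro!: eq_matI)
  finally have UQ: "rat_mat (V * Q) = UQ_matrix mQ p lam ord U * rat_mat Q"
    using to_fract_hom.mat_hom_mult[OF V dims(1)] by simp
  have Q_entry: "to_fract (Q $$ (l, j)) =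
      svar powi (- lam l) * to_fract [:poly (Q $$ (l, j)) 1:] * svar powi mu j"
    if "l < mQ" "j < n" for l j
    using lam_mu that by (simp add: dim_consistent_with_iff[OF dims(1)])
  have "dim_consistent_with lam mu (V * Q)"
    unfolding dim_consistent_with_iff[OF VQ]
  proof (intro allI impI)
    fix i j assume ij: "i < mQ" "j < n"
    have entry: "(V * Q) $$ (i, j) = (\<Sum>l<mQ. V $$ (i, l) * Q $$ (l, j))"
      using ij V dims(1) by (auto simp: scalar_prod_def atLeast0LessThan)
    \<comment> \<open>Consistency is proved for each summand with exponents independent of
      \<open>l\<close>; the common powers of s can then be factored out of the sum. Where
      \<open>B\<close> vanishes, so do both sides, so membership in the same class may be
      assumed.\<close>
    have summand: "to_fract (V $$ (i, l) * Q $$ (l, j)) =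
        svar powi (- lam i) * to_fract [:poly (V $$ (i, l) * Q $$ (l, j)) 1:] * svar powi mu j"
      if l: "l < mQ" for l
    proof (cases "B $$ (i, l) = 0")
      case True
      then show ?thesis
        using ij l by (simp add: V_def)
    next
      case False
      \<comment> \<open>Equal classes mean p_l - lam_l = p_i - lam_i, which removes \<open>l\<close>
        from the exponent.\<close>
      have powers: "svar powi (- p i) * svar powi p l * svar powi (- lam l) =
          (svar :: 'f poly fract) powi (- lam i)"
        using B_nonzero[OF ij(1) l False]
        by (simp add: power_int_add[symmetric] svar_nonzero cls_def algebra_simps)
      have at_1: "[:poly (V $$ (i, l) * Q $$ (l, j)) 1:] =
          [:B $$ (i, l):] * [:poly (Q $$ (l, j)) 1:]"
        using ij l by (simp add: V_def poly_monom)
      have "to_fract (V $$ (i, l) * Q $$ (l, j)) =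
          (svar powi (- p i) * svar powi p l * svar powi (- lam l)) *
          (to_fract [:B $$ (i, l):] * to_fract [:poly (Q $$ (l, j)) 1:]) * svar powi mu j"
        unfolding to_fract_hom.hom_mult V_entry[OF ij(1) l] Q_entry[OF l ij(2)]
        by (simp only: mult_ac)
      then show ?thesis
        unfolding powers at_1 to_fract_hom.hom_mult .
    qed
    have at_1: "[:poly ((V * Q) $$ (i, j)) 1:] =
        (\<Sum>l<mQ. [:poly (V $$ (i, l) * Q $$ (l, j)) 1:])"
      by (simp add: entry poly_sum flip: sum_to_poly)
    show "to_fract ((V * Q) $$ (i, j)) =
        svar powi (- lam i) * to_fract [:poly ((V * Q) $$ (i, j)) 1:] * svar powi mu j"
      \<comment> \<open>The order matters: \<open>at_1\<close> must rewrite the value at 1 before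
        \<open>entry\<close> expands the matrix entry occurring in its left-hand side.\<close>
      unfolding at_1 unfolding entry to_fract_hom.hom_sum sum_distrib_left sum_distrib_right
      using summand by (intro sum.cong) auto
  qed
  \<comment> \<open>\<open>T\<close> is unchanged, so algebraic independence carries over; what
    remains is that the coefficients of \<open>V * Q\<close> lie in \<open>K\<close>.\<close>
  moreover have "LM_poly_matrix K (V * Q) T"
  proof -
    have LM: "LM_poly_matrix K Q T"
      using DCLM by (simp add: DCLM_poly_matrix_def)
    have "coeff (V $$ (i, l)) k \<in> K" if "i < mQ" "l < mQ" for i l k
      using B_in_K[OF that] that K by (auto simp: V_def is_subfield_def)
    moreover have "coeff (Q $$ (i, j)) k \<in> K" if "i < mQ" "j < n" for i j k
      using LM that dims(1) by (auto simp: LM_poly_matrix_def)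
    ultimately have "coeff ((V * Q) $$ (i, j)) k \<in> K" if "i < mQ" "j < n" for i j k
      using is_subfield_coeff_mult_mat[OF K V dims(1)] that by blast
    then show ?thesis
      using LM V dims by (auto simp: LM_poly_matrix_def)
  qed
  ultimately show ?thesis
    using UQ unfolding DCLM_poly_matrix_def by blast
qed

end
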